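(* Let $p,q,r>1$, $A>0$, $B>0$, $R\ge 1$, and let $(f,g)\in C_0^2(\mathbf{R})\times C_0^1(\mathbf{R})$ satisfy $\mathrm{supp}\,f,\ \mathrm{supp}\,g\subset\{x\in\mathbf{R}: |x|\le R\}$ and $$\int_{\mathbf{R}}g(x)\,dx>0.$$ Then there exist a positive constant $\varepsilon_3=\varepsilon_3(f,g,p,q,r,A,B,R)>0$ and a positive constant $C$ independent of $\varepsilon$ such that, for every $\varepsilon$ with $0<\varepsilon\le\varepsilon_3$, no classical solution of the initial value problem $$u_{tt}-u_{xx}=A|u_t|^p|u|^q+B|u|^r,\qquad u(x,0)=\varepsilon f(x),\quad u_t(x,0)=\varepsilon g(x)\quad (x\in\mathbf{R})$$ in the time interval $[0,T]$ can exist as far as $T$ satisfies $$T\ge\begin{cases} C\,\varepsilon^{-(p+q-1)} & \text{if } p+q\le\dfrac{r+1}{2},\\[2mm] C\,\varepsilon^{-(r-1)/2} & \text{if } \dfrac{r+1}{2}\le p+q.\end{cases}$$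
   Context: $C_0^k(\mathbf{R})$ denotes the real-valued $C^k$ functions on $\mathbf{R}$ with compact support. A classical solution in the time interval $[0,T]$ is a real-valued function $u\in C^2(\mathbf{R}\times[0,T])$ satisfying the equation and the initial conditions pointwise. The space dimension is one. *)

theory Defs
  imports "HOL-Analysis.Analysis"
begin

definition supp :: "(real \<Rightarrow> real) \<Rightarrow> real set" where
  "supp f = closure {x. f x \<noteq> 0}"

fun Ck :: "nat \<Rightarrow> (real \<Rightarrow> real) \<Rightarrow> bool" where
  "Ck 0 f \<longleftrightarrow> continuous_on UNIV f"
| "Ck (Suc k) f \<longleftrightarrow> (\<forall>x. f differentiable (at x)) \<and> Ck k (deriv f)"

definition C0k :: "nat \<Rightarrow> (real \<Rightarrow> real) set" where
  "C0k k = {f. Ck k f \<and> compact (supp f)}"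

text \<open>
  Functions of space and time are functions of the pair \<open>(x, t)\<close>.  On the slab
  \<open>\<real> \<times> [0, T]\<close> the time derivative is taken within \<open>[0, T]\<close>, so it is
  one-sided at \<open>t = 0\<close> and \<open>t = T\<close>; the value of a function outside the slab is irrelevant.
  These notions are meant for \<open>T > 0\<close>.
\<close>

definition slab :: "real \<Rightarrow> (real \<times> real) set" where
  "slab T = UNIV \<times> {0..T}"

definition pd_x :: "(real \<times> real \<Rightarrow> real) \<Rightarrow> real \<times> real \<Rightarrow> real" where
  "pd_x u = (\<lambda>(x, t). deriv (\<lambda>y. u (y, t)) x)"

definition pd_t :: "real \<Rightarrow> (real \<times> real \<Rightarrow> real) \<Rightarrow> real \<times> real \<Rightarrow> real" where
  "pd_t T u = (\<lambda>(x, t). vector_derivative (\<lambda>s. u (x, s)) (at t within {0..T}))"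

text \<open>All partial derivatives of order at most \<open>k\<close>, mixed ones in every order of
  differentiation, exist and are continuous on the slab.\<close>

fun Ck_slab :: "nat \<Rightarrow> real \<Rightarrow> (real \<times> real \<Rightarrow> real) \<Rightarrow> bool" where
  "Ck_slab 0 T u \<longleftrightarrow> continuous_on (slab T) u"
| "Ck_slab (Suc k) T u \<longleftrightarrow>
     continuous_on (slab T) u \<and>
     (\<forall>x. \<forall>t\<in>{0..T}. (\<lambda>y. u (y, t)) differentiable (at x) \<and>
        (\<lambda>s. u (x, s)) differentiable (at t within {0..T})) \<and>
     Ck_slab k T (pd_x u) \<and> Ck_slab k T (pd_t T u)"

text \<open>Powers of absolute values are written with \<open>powr\<close>; since \<open>0 powr a = 0\<close>, this is the
  usual convention for the exponents greater than \<open>1\<close> considered here.\<close>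

definition classical_solution ::
  "real \<Rightarrow> real \<Rightarrow> real \<Rightarrow> real \<Rightarrow> real \<Rightarrow> (real \<Rightarrow> real) \<Rightarrow> (real \<Rightarrow> real) \<Rightarrow> real \<Rightarrow> real
     \<Rightarrow> (real \<times> real \<Rightarrow> real) \<Rightarrow> bool" where
  "classical_solution p q r A B f g \<epsilon> T u \<longleftrightarrow>
     Ck_slab 2 T u \<and>
     (\<forall>x. \<forall>t\<in>{0..T}.
        pd_t T (pd_t T u) (x, t) - pd_x (pd_x u) (x, t)
          = A * \<bar>pd_t T u (x, t)\<bar> powr p * \<bar>u (x, t)\<bar> powr q + B * \<bar>u (x, t)\<bar> powr r) \<and>
     (\<forall>x. u (x, 0) = \<epsilon> * f x) \<and>
     (\<forall>x. pd_t T u (x, 0) = \<epsilon> * g x)"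

end

theory Submission
  imports Defs
begin

text \<open>
  The proof runs along the characteristics.  Put \<open>F = A |u_t|^p |u|^q + B |u|^r \<ge> 0\<close>.  Since
  \<open>(\<partial>_t + \<partial>_x)(u_t - u_x) = F = (\<partial>_t - \<partial>_x)(u_t + u_x)\<close>, the Riemann invariant \<open>u_t - u_x\<close> does not
  decrease along the lines \<open>x - t = const\<close>, nor \<open>u_t + u_x\<close> along the lines \<open>x + t = const\<close>.
  Integrating \<open>(\<partial>_t - \<partial>_x) u = u_t - u_x\<close> once more bounds \<open>u\<close> below by the free wave with the
  same data (\<open>u_ge_free_wave\<close>).  For data vanishing where \<open>|x| \<ge> L\<close>, that wave equals
  \<open>(\<epsilon>/2) \<integral>g > 0\<close> on the forward cone \<open>|x| \<le> t - L\<close>: in one dimension there is no decay.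

  Either part of \<open>F\<close> alone then gives an upper bound for the lifespan, so no interaction of the two has
  to be studied; the threshold in the theorem only picks the better bound.

  \<^item> With \<open>B |u|^r\<close> (\<open>lifespan_power\<close>): if \<open>u \<ge> M\<close> on the cone \<open>|x| \<le> t - a\<close>, then two integrations
    over a characteristic rectangle with sides of order \<open>\<delta>\<close> gain \<open>B M^r \<delta>^2 / 4\<close>.  This equals
    \<open>M\<close> for \<open>\<delta>\<close> proportional to \<open>M^(-(r-1)/2)\<close>, so \<open>u \<ge> 2 M\<close> on the cone \<open>|x| \<le> t - a - \<delta>\<close>.

  \<^item> With \<open>A |u_t|^p |u|^q\<close> (\<open>lifespan_product\<close>): because \<open>\<integral>g > 0\<close> there is a line \<open>x - t = \<sigma>\<close> on which
    both \<open>u_t - u_x\<close> and, from the time \<open>L\<close> on, the free wave are bounded below by a multiple of \<open>\<epsilon>\<close>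
    (\<open>ex_growing_characteristic\<close>).  After the time \<open>L\<close> the other invariant is nonnegative there,
    so \<open>H = u_t - u_x\<close> satisfies \<open>u_t \<ge> H / 2\<close> and \<open>H' \<ge> c \<epsilon>^q H^p\<close> along the line.  It starts at the
    size \<open>\<epsilon>\<close>, and hence it rises from \<open>M\<close> to at least \<open>2 M\<close> within a time proportional to
    \<open>\<epsilon>^(-q) M^(-(p-1))\<close>.

  In both cases a quantity doubles after waiting times that form a convergent geometric series, which
  forces blow-up in finite time (\<open>doubling_blowup\<close>).  The sums of these series are of the order
  \<open>\<epsilon>^(-(r-1)/2)\<close> and \<open>\<epsilon>^(-(p+q-1))\<close>.
\<close>

section \<open>Calculus of two variables\<close>

lemma second_difference_mvt:
  fixes w wx wxt :: "real \<times> real \<Rightarrow> real"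
  assumes "a < b" "c < d"
    and wx: "\<And>x t. x \<in> {a..b} \<Longrightarrow> t \<in> {c..d} \<Longrightarrow>
      ((\<lambda>y. w (y, t)) has_real_derivative wx (x, t)) (at x)"
    and wxt: "\<And>x t. x \<in> {a..b} \<Longrightarrow> t \<in> {c..d} \<Longrightarrow>
      ((\<lambda>s. wx (x, s)) has_real_derivative wxt (x, t)) (at t)"
  shows "\<exists>x\<in>{a..b}. \<exists>t\<in>{c..d}.
    w (b, d) - w (a, d) - w (b, c) + w (a, c) = (b - a) * (d - c) * wxt (x, t)"
proof -
  have "\<exists>x. a < x \<and> x < b \<and> (w (b, d) - w (b, c)) - (w (a, d) - w (a, c))
      = (b - a) * (wx (x, d) - wx (x, c))"
    using assms by (intro MVT2) (auto intro!: DERIV_diff)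
  then obtain x where x: "x \<in> {a..b}"
    and dx: "(w (b, d) - w (b, c)) - (w (a, d) - w (a, c)) = (b - a) * (wx (x, d) - wx (x, c))"
    by (metis atLeastAtMost_iff less_imp_le)
  have "\<exists>t. c < t \<and> t < d \<and> wx (x, d) - wx (x, c) = (d - c) * wxt (x, t)"
    using x \<open>c < d\<close> by (intro MVT2 wxt) auto
  then obtain t where t: "t \<in> {c..d}" and dt: "wx (x, d) - wx (x, c) = (d - c) * wxt (x, t)"
    by (metis atLeastAtMost_iff less_imp_le)
  have "w (b, d) - w (a, d) - w (b, c) + w (a, c) = (b - a) * (d - c) * wxt (x, t)"
    using dx unfolding dt by simp
  with x t show ?thesis by blast
qed

text \<open>
  Schwarz's theorem.  By the previous lemma, used also with the variables exchanged, the second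
  difference over a small square with corner \<open>(x, t)\<close>, divided by the area, is a value of \<open>wxt\<close> and a
  value of \<open>wtx\<close> in that square; continuity turns this into equality at the corner.
\<close>

lemma mixed_partials_commute:
  fixes w wx wt wxt wtx :: "real \<times> real \<Rightarrow> real"
  assumes "open S" and z: "(x, t) \<in> S"
    and wx: "\<And>x t. (x, t) \<in> S \<Longrightarrow> ((\<lambda>y. w (y, t)) has_real_derivative wx (x, t)) (at x)"
    and wt: "\<And>x t. (x, t) \<in> S \<Longrightarrow> ((\<lambda>s. w (x, s)) has_real_derivative wt (x, t)) (at t)"
    and wxt: "\<And>x t. (x, t) \<in> S \<Longrightarrow> ((\<lambda>s. wx (x, s)) has_real_derivative wxt (x, t)) (at t)"
    and wtx: "\<And>x t. (x, t) \<in> S \<Longrightarrow> ((\<lambda>y. wt (y, t)) has_real_derivative wtx (x, t)) (at x)"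
    and cont: "continuous_on S wxt" "continuous_on S wtx"
  shows "wxt (x, t) = wtx (x, t)"
proof (rule ccontr)
  assume neq: "wxt (x, t) \<noteq> wtx (x, t)"
  define e where "e = \<bar>wxt (x, t) - wtx (x, t)\<bar> / 2"
  have "e > 0" using neq by (simp add: e_def)
  have "isCont wxt (x, t)" "isCont wtx (x, t)"
    using cont z \<open>open S\<close> by (auto simp: continuous_on_eq_continuous_at)
  with \<open>e > 0\<close> obtain d1 d2 where "d1 > 0" "d2 > 0"
    and d1: "\<And>y. dist y (x, t) < d1 \<Longrightarrow> dist (wxt y) (wxt (x, t)) < e"
    and d2: "\<And>y. dist y (x, t) < d2 \<Longrightarrow> dist (wtx y) (wtx (x, t)) < e"
    unfolding continuous_at_eps_delta by metis
  obtain d3 where "d3 > 0" and d3: "\<And>y. dist y (x, t) < d3 \<Longrightarrow> y \<in> S"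
    using \<open>open S\<close> z unfolding open_dist by blast
  define d where "d = min d1 (min d2 d3) / 3"
  have "d > 0" using \<open>d1 > 0\<close> \<open>d2 > 0\<close> \<open>d3 > 0\<close> by (simp add: d_def)
  have near: "dist (y, s) (x, t) < d1" "dist (y, s) (x, t) < d2" "(y, s) \<in> S"
    if "y \<in> {x..x + d}" "s \<in> {t..t + d}" for y s
  proof -
    have "dist (y, s) (x, t) \<le> \<bar>y - x\<bar> + \<bar>s - t\<bar>"
      using sqrt_sum_squares_le_sum_abs[of "y - x" "s - t"] by (simp add: dist_prod_def dist_real_def)
    also have "\<dots> \<le> 2 * d" using that by auto
    also have "\<dots> < 3 * d" using \<open>d > 0\<close> by simp
    also have "\<dots> = min d1 (min d2 d3)" by (simp add: d_def)
    finally show "dist (y, s) (x, t) < d1" "dist (y, s) (x, t) < d2" "(y, s) \<in> S"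
      by (auto intro: d3)
  qed
  obtain y1 s1 where 1: "y1 \<in> {x..x + d}" "s1 \<in> {t..t + d}"
    and e1: "w (x + d, t + d) - w (x, t + d) - w (x + d, t) + w (x, t)
       = (x + d - x) * (t + d - t) * wxt (y1, s1)"
    using second_difference_mvt[of x "x + d" t "t + d" w wx wxt] \<open>d > 0\<close> near wx wxt
    by (metis less_add_same_cancel1)
  have "\<exists>s\<in>{t..t + d}. \<exists>y\<in>{x..x + d}.
      (\<lambda>(s, y). w (y, s)) (t + d, x + d) - (\<lambda>(s, y). w (y, s)) (t, x + d)
        - (\<lambda>(s, y). w (y, s)) (t + d, x) + (\<lambda>(s, y). w (y, s)) (t, x)
       = (t + d - t) * (x + d - x) * (\<lambda>(s, y). wtx (y, s)) (s, y)"
    using \<open>d > 0\<close> near wt wtx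
    by (intro second_difference_mvt[where wx = "\<lambda>(s, y). wt (y, s)"]) auto
  then obtain y2 s2 where 2: "y2 \<in> {x..x + d}" "s2 \<in> {t..t + d}"
    and e2: "w (x + d, t + d) - w (x, t + d) - w (x + d, t) + w (x, t)
       = (x + d - x) * (t + d - t) * wtx (y2, s2)"
    by (auto simp: algebra_simps)
  have "wxt (y1, s1) = wtx (y2, s2)" using e1 e2 \<open>d > 0\<close> by simp
  moreover have "\<bar>wxt (y1, s1) - wxt (x, t)\<bar> < e" "\<bar>wtx (y2, s2) - wtx (x, t)\<bar> < e"
    using d1[OF near(1)[OF 1]] d2[OF near(2)[OF 2]] by (auto simp: dist_real_def)
  ultimately have "\<bar>wxt (x, t) - wtx (x, t)\<bar> < 2 * e" by linarith
  then show False by (simp add: e_def)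
qed

text \<open>
  The chain rule needs total differentiability at one point, for which continuity of only one of the
  two partial derivatives suffices.
\<close>

lemma has_real_derivative_along_line:
  fixes w wt :: "real \<times> real \<Rightarrow> real"
  assumes s: "s \<in> {0<..<T}"
    and wx: "((\<lambda>y. w (y, s)) has_real_derivative wx) (at (\<xi> + c * s))"
    and wt: "\<And>x t. t \<in> {0<..<T} \<Longrightarrow> ((\<lambda>s. w (x, s)) has_real_derivative wt (x, t)) (at t)"
    and cont: "continuous_on (UNIV \<times> {0<..<T}) wt"
  shows "((\<lambda>s. w (\<xi> + c * s, s)) has_real_derivative (c * wx + wt (\<xi> + c * s, s))) (at s)"
proof -
  have op: "open (UNIV \<times> {0<..<T} :: (real \<times> real) set)" by (intro open_Times) auto
  have mem: "(\<xi> + c * s, s) \<in> UNIV \<times> {0<..<T}" using s by auto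
  have "continuous (at (\<xi> + c * s, s) within UNIV \<times> {0<..<T}) wt"
    using cont mem by (auto simp: continuous_on_eq_continuous_within)
  then have c2: "continuous (at (\<xi> + c * s, s) within UNIV \<times> {0<..<T})
      (\<lambda>(x, t). blinfun_mult_right (wt (x, t)))"
    unfolding case_prod_beta' prod.collapse
    by (rule bounded_linear.continuous[OF bounded_linear_blinfun_mult_right])
  have "((\<lambda>(x, t). w (x, t)) has_derivative
        (\<lambda>(tx, ty). wx * tx + blinfun_apply (blinfun_mult_right (wt (\<xi> + c * s, s))) ty))
      (at (\<xi> + c * s, s) within UNIV \<times> {0<..<T})"
  proof (rule has_derivative_partialsI[OF _ _ c2])
    show "((\<lambda>x. w (x, s)) has_derivative (*) wx) (at (\<xi> + c * s) within UNIV)"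
      using wx by (simp add: has_field_derivative_def)
  next
    fix x y assume "y \<in> {0<..<T}"
    then show "((\<lambda>t. w (x, t)) has_derivative blinfun_apply (blinfun_mult_right (wt (x, y))))
        (at y within {0<..<T})"
      using wt[of y x] by (auto simp: has_field_derivative_def intro: has_derivative_at_withinI)
  qed (use s in auto)
  then have D: "(w has_derivative (\<lambda>z. wx * fst z + wt (\<xi> + c * s, s) * snd z))
      (at (\<xi> + c * s, s))"
    using at_within_open[OF mem op] by (simp add: case_prod_beta')
  have L: "((\<lambda>s. (\<xi> + c * s, s)) has_derivative (\<lambda>h. (c * h, h))) (at s)"
    by (auto intro!: derivative_eq_intros)
  have "(\<lambda>h. wx * fst (c * h, h) + wt (\<xi> + c * s, s) * snd (c * h, h))
      = (*) (c * wx + wt (\<xi> + c * s, s))"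
    by (auto simp: fun_eq_iff algebra_simps)
  with has_derivative_compose[OF L D] show ?thesis
    by (simp add: has_field_derivative_def)
qed

lemma increment_ge_of_deriv_ge:
  fixes \<phi> \<phi>' :: "real \<Rightarrow> real"
  assumes "a \<le> b" and cont: "continuous_on {a..b} \<phi>"
    and der: "\<And>s. s \<in> {a<..<b} \<Longrightarrow> (\<phi> has_real_derivative \<phi>' s) (at s)"
    and ge: "\<And>s. s \<in> {a<..<b} \<Longrightarrow> m \<le> \<phi>' s"
  shows "\<phi> a + m * (b - a) \<le> \<phi> b"
proof (cases "a < b")
  case True
  then obtain l z where z: "a < z" "z < b" "(\<phi> has_real_derivative l) (at z)"
      "\<phi> b - \<phi> a = (b - a) * l"
    using MVT[OF True cont] der by (metis greaterThanLessThan_iff real_differentiable_def)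
  then have "m \<le> l" using der ge DERIV_unique by (metis greaterThanLessThan_iff)
  then have "m * (b - a) \<le> l * (b - a)" using \<open>a \<le> b\<close> by (intro mult_right_mono) auto
  with z show ?thesis by (simp add: algebra_simps)
qed (use assms in auto)

section \<open>Blow-up by repeated doubling\<close>

text \<open>
  Read \<open>P M a\<close> as: from time \<open>a\<close> on, the quantity under study is at least \<open>M\<close>.  Reaching the level
  \<open>2^n M0\<close> takes at most the time \<open>K M0^(-s) (1 + 2^(-s) + \<dots> + 2^(-s (n - 1)))\<close>, which stays below the sum
  of the full geometric series.  If that sum fitted into the time available, every level would be
  reached by the time \<open>T\<close>, against the bound \<open>W\<close>.
\<close>

lemma doubling_blowup:
  fixes P :: "real \<Rightarrow> real \<Rightarrow> bool"
  assumes "K > 0" "s > 0" "M0 > 0" and init: "P M0 a0"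
    and step: "\<And>M a. M > 0 \<Longrightarrow> a \<ge> a0 \<Longrightarrow> P M a \<Longrightarrow> P (2 * M) (a + K * M powr (- s))"
    and bdd: "\<And>M a. P M a \<Longrightarrow> a \<le> T \<Longrightarrow> M \<le> W"
  shows "T < a0 + K / (1 - 2 powr (- s)) * M0 powr (- s)"
proof (rule ccontr)
  assume "\<not> ?thesis"
  then have T: "a0 + K / (1 - 2 powr (- s)) * M0 powr (- s) \<le> T" by simp
  define \<rho> :: real where "\<rho> = 2 powr (- s)"
  have \<rho>: "0 < \<rho>" "\<rho> < 1" using \<open>s > 0\<close> by (auto simp: \<rho>_def powr_less_one)
  define a where "a n = a0 + K * M0 powr (- s) * (\<Sum>i<n. \<rho> ^ i)" for n :: nat
  have a_ge: "a0 \<le> a n" for n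
    using \<open>K > 0\<close> \<rho> by (auto simp: a_def intro!: mult_nonneg_nonneg sum_nonneg)
  have P: "P (2 ^ n * M0) (a n)" for n
  proof (induction n)
    case 0
    then show ?case using init by (simp add: a_def)
  next
    case (Suc n)
    have "(2 ^ n * M0) powr (- s) = \<rho> ^ n * M0 powr (- s)"
      using \<open>M0 > 0\<close> by (simp add: powr_mult \<rho>_def powr_power powr_realpow[symmetric] powr_powr mult.commute)
    then have "a (Suc n) = a n + K * (2 ^ n * M0) powr (- s)"
      by (simp add: a_def algebra_simps)
    with step[OF _ a_ge Suc.IH] \<open>M0 > 0\<close> show ?case by (simp add: mult.assoc)
  qed
  have "a n \<le> T" for n
  proof -
    have "(\<Sum>i<n. \<rho> ^ i) \<le> 1 / (1 - \<rho>)"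
      using \<rho> by (simp add: sum_gp_strict divide_right_mono)
    then have "K * M0 powr (- s) * (\<Sum>i<n. \<rho> ^ i) \<le> K * M0 powr (- s) * (1 / (1 - \<rho>))"
      using \<open>K > 0\<close> by (intro mult_left_mono) auto
    with T show ?thesis by (simp add: a_def \<rho>_def mult.commute)
  qed
  then have "2 ^ n * M0 \<le> W" for n using P bdd by blast
  moreover obtain n where "W / M0 < 2 ^ n" using real_arch_pow[of 2 "W / M0"] by auto
  ultimately show False using \<open>M0 > 0\<close> by (metis linorder_not_less pos_divide_less_eq)
qed

section \<open>Derivatives on the slab\<close>

lemma Ck_slab_deriv_x:
  assumes "Ck_slab (Suc k) T w" "t \<in> {0..T}"
  shows "((\<lambda>y. w (y, t)) has_real_derivative pd_x w (x, t)) (at x)"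
  using assms by (auto simp: pd_x_def DERIV_deriv_iff_real_differentiable)

text \<open>
  Away from the two ends of the time interval the one-sided time derivative is an ordinary one.
  Functions are therefore differentiated along lines in the open strip only, and the ends of the
  time interval are reached by continuity.
\<close>

lemma Ck_slab_deriv_t:
  assumes "Ck_slab (Suc k) T w" "t \<in> {0<..<T}"
  shows "((\<lambda>s. w (x, s)) has_real_derivative pd_t T w (x, t)) (at t)"
proof -
  have "(\<lambda>s. w (x, s)) differentiable (at t within {0..T})" using assms by auto
  then have "((\<lambda>s. w (x, s)) has_vector_derivative pd_t T w (x, t)) (at t within {0..T})"
    by (simp add: pd_t_def vector_derivative_works)
  moreover have "at t within {0..T} = at t" using assms by (intro at_within_Icc_at) auto
  ultimately show ?thesis by (simp add: has_real_derivative_iff_has_vector_derivative)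
qed

lemma Ck_slab_continuous_on: "Ck_slab k T w \<Longrightarrow> continuous_on (slab T) w"
  by (cases k) auto

lemma Ck_slab_pd:
  assumes "Ck_slab (Suc k) T w"
  shows "Ck_slab k T (pd_x w)" "Ck_slab k T (pd_t T w)"
  using assms by auto

lemma open_strip_subset_slab: "UNIV \<times> {0<..<T} \<subseteq> slab T"
  by (auto simp: slab_def)

lemma Ck_slab_deriv_line:
  assumes w: "Ck_slab (Suc k) T w" and s: "s \<in> {0<..<T}"
  shows "((\<lambda>s. w (\<xi> + c * s, s)) has_real_derivative
    (c * pd_x w (\<xi> + c * s, s) + pd_t T w (\<xi> + c * s, s))) (at s)"
proof (rule has_real_derivative_along_line[OF s])
  show "((\<lambda>y. w (y, s)) has_real_derivative pd_x w (\<xi> + c * s, s)) (at (\<xi> + c * s))"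
    using s by (intro Ck_slab_deriv_x[OF w]) auto
  show "continuous_on (UNIV \<times> {0<..<T}) (pd_t T w)"
    using Ck_slab_continuous_on[OF Ck_slab_pd(2)[OF w]] open_strip_subset_slab
    by (rule continuous_on_subset)
qed (rule Ck_slab_deriv_t[OF w])

lemma continuous_on_line:
  assumes "continuous_on (slab T) w" "0 \<le> a" "b \<le> T"
  shows "continuous_on {a..b} (\<lambda>s. w (\<xi> + c * s, s))"
  by (rule continuous_on_compose2[OF assms(1)])
    (use assms in \<open>auto simp: slab_def intro!: continuous_intros\<close>)

lemma Ck_slab_mixed_partials_commute:
  assumes w: "Ck_slab (Suc (Suc k)) T w" and t: "t \<in> {0<..<T}"
  shows "pd_t T (pd_x w) (x, t) = pd_x (pd_t T w) (x, t)"
proof (rule mixed_partials_commute[where S = "UNIV \<times> {0<..<T}" and w = w])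
  note wx = Ck_slab_pd(1)[OF w] and wt = Ck_slab_pd(2)[OF w]
  show "open (UNIV \<times> {0<..<T} :: (real \<times> real) set)" by (intro open_Times) auto
  show "((\<lambda>y. w (y, t)) has_real_derivative pd_x w (x, t)) (at x)"
    if "(x, t) \<in> UNIV \<times> {0<..<T}" for x t using that by (intro Ck_slab_deriv_x[OF w]) auto
  show "((\<lambda>y. pd_t T w (y, t)) has_real_derivative pd_x (pd_t T w) (x, t)) (at x)"
    if "(x, t) \<in> UNIV \<times> {0<..<T}" for x t using that by (intro Ck_slab_deriv_x[OF wt]) auto
  show "((\<lambda>s. w (x, s)) has_real_derivative pd_t T w (x, t)) (at t)"
    if "(x, t) \<in> UNIV \<times> {0<..<T}" for x t using that by (intro Ck_slab_deriv_t[OF w]) auto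
  show "((\<lambda>s. pd_x w (x, s)) has_real_derivative pd_t T (pd_x w) (x, t)) (at t)"
    if "(x, t) \<in> UNIV \<times> {0<..<T}" for x t using that by (intro Ck_slab_deriv_t[OF wx]) auto
  show "continuous_on (UNIV \<times> {0<..<T}) (pd_t T (pd_x w))"
    using Ck_slab_continuous_on[OF Ck_slab_pd(2)[OF wx]] open_strip_subset_slab
    by (rule continuous_on_subset)
  show "continuous_on (UNIV \<times> {0<..<T}) (pd_x (pd_t T w))"
    using Ck_slab_continuous_on[OF Ck_slab_pd(1)[OF wt]] open_strip_subset_slab
    by (rule continuous_on_subset)
qed (use t in auto)

section \<open>Riemann invariants\<close>

locale forced_wave =
  fixes T :: real and u F :: "real \<times> real \<Rightarrow> real"
  assumes u_C2: "Ck_slab 2 T u"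
    and wave_eq: "\<And>x t. t \<in> {0..T} \<Longrightarrow>
      pd_t T (pd_t T u) (x, t) - pd_x (pd_x u) (x, t) = F (x, t)"
begin

text \<open>The Riemann invariant that a free wave transports unchanged to the right.\<close>

definition hR :: "real \<times> real \<Rightarrow> real" where
  "hR z = pd_t T u z - pd_x u z"

text \<open>The Riemann invariant that a free wave transports unchanged to the left.\<close>

definition hL :: "real \<times> real \<Rightarrow> real" where
  "hL z = pd_t T u z + pd_x u z"

lemma u_C2': "Ck_slab (Suc (Suc 0)) T u"
  using u_C2 by (simp add: numeral_2_eq_2)

lemmas ux_C1 = Ck_slab_pd(1)[OF u_C2'] and ut_C1 = Ck_slab_pd(2)[OF u_C2']

lemma continuous_on_hR: "continuous_on (slab T) hR"
  unfolding hR_def[abs_def]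
  by (intro continuous_on_diff Ck_slab_continuous_on[OF ux_C1] Ck_slab_continuous_on[OF ut_C1])

lemma continuous_on_hL: "continuous_on (slab T) hL"
  unfolding hL_def[abs_def]
  by (intro continuous_on_add Ck_slab_continuous_on[OF ux_C1] Ck_slab_continuous_on[OF ut_C1])

text \<open>
  Along \<open>x = \<xi> + s\<close> the derivative of \<open>u_t - u_x\<close> is \<open>u_tt + u_tx - u_xt - u_xx\<close>; the mixed terms cancel
  and the wave equation leaves \<open>F\<close>.
\<close>

lemma hR_increment:
  assumes "0 \<le> a" "a \<le> b" "b \<le> T" and "\<And>s. s \<in> {a<..<b} \<Longrightarrow> m \<le> F (\<xi> + s, s)"
  shows "hR (\<xi> + a, a) + m * (b - a) \<le> hR (\<xi> + b, b)"
proof (rule increment_ge_of_deriv_ge[where \<phi> = "\<lambda>s. hR (\<xi> + s, s)" and \<phi>' = "\<lambda>s. F (\<xi> + s, s)"])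
  show "continuous_on {a..b} (\<lambda>s. hR (\<xi> + s, s))"
    using continuous_on_line[OF continuous_on_hR, of a b \<xi> 1] assms by simp
  fix s assume "s \<in> {a<..<b}"
  then have s: "s \<in> {0<..<T}" "s \<in> {0..T}" using assms by auto
  show "((\<lambda>s. hR (\<xi> + s, s)) has_real_derivative F (\<xi> + s, s)) (at s)"
    using DERIV_diff[OF Ck_slab_deriv_line[OF ut_C1 s(1), of \<xi> 1] Ck_slab_deriv_line[OF ux_C1 s(1), of \<xi> 1]]
      Ck_slab_mixed_partials_commute[OF u_C2' s(1), of "\<xi> + s"] wave_eq[OF s(2), of "\<xi> + s"]
    by (simp add: hR_def algebra_simps)
qed (use assms in auto)

lemma hL_increment:
  assumes "0 \<le> a" "a \<le> b" "b \<le> T" and "\<And>s. s \<in> {a<..<b} \<Longrightarrow> m \<le> F (\<eta> - s, s)"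
  shows "hL (\<eta> - a, a) + m * (b - a) \<le> hL (\<eta> - b, b)"
proof (rule increment_ge_of_deriv_ge[where \<phi> = "\<lambda>s. hL (\<eta> - s, s)" and \<phi>' = "\<lambda>s. F (\<eta> - s, s)"])
  show "continuous_on {a..b} (\<lambda>s. hL (\<eta> - s, s))"
    using continuous_on_line[OF continuous_on_hL, of a b \<eta> "-1"] assms by simp
  fix s assume "s \<in> {a<..<b}"
  then have s: "s \<in> {0<..<T}" "s \<in> {0..T}" using assms by auto
  show "((\<lambda>s. hL (\<eta> - s, s)) has_real_derivative F (\<eta> - s, s)) (at s)"
    using DERIV_add[OF Ck_slab_deriv_line[OF ut_C1 s(1), of \<eta> "-1"] Ck_slab_deriv_line[OF ux_C1 s(1), of \<eta> "-1"]]
      Ck_slab_mixed_partials_commute[OF u_C2' s(1), of "\<eta> - s"] wave_eq[OF s(2), of "\<eta> - s"]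
    by (simp add: hL_def algebra_simps)
qed (use assms in auto)

lemma has_real_derivative_u_left:
  assumes "s \<in> {0<..<T}"
  shows "((\<lambda>s. u (\<eta> - s, s)) has_real_derivative hR (\<eta> - s, s)) (at s)"
  using Ck_slab_deriv_line[OF u_C2' assms, of \<eta> "-1"] by (simp add: hR_def)

lemma continuous_on_u_left:
  assumes "0 \<le> a" "b \<le> T"
  shows "continuous_on {a..b} (\<lambda>s. u (\<eta> - s, s))"
  using continuous_on_line[OF Ck_slab_continuous_on[OF u_C2'] assms, of \<eta> "-1"] by simp

lemma u_increment:
  assumes "0 \<le> a" "a \<le> b" "b \<le> T" and "\<And>s. s \<in> {a<..<b} \<Longrightarrow> m \<le> hR (\<eta> - s, s)"
  shows "u (\<eta> - a, a) + m * (b - a) \<le> u (\<eta> - b, b)"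
  using assms by (intro increment_ge_of_deriv_ge[where \<phi>' = "\<lambda>s. hR (\<eta> - s, s)"]
      continuous_on_u_left has_real_derivative_u_left) auto

end

section \<open>Initial data\<close>

text \<open>
  The primitive \<open>E\<close> of \<open>g - f'\<close> replaces the integrals in d'Alembert's formula: the solution of the
  free problem with data \<open>f\<close>, \<open>g\<close> is \<open>f (x + t) + (E (x + t) - E (x - t)) / 2\<close>.  As \<open>f\<close> vanishes at \<open>L\<close>
  and \<open>- L\<close>, the assumption \<open>E (- L) < E L\<close> says that \<open>g\<close> has a positive integral.
\<close>

locale cauchy_data =
  fixes f f' g E :: "real \<Rightarrow> real" and L :: real
  assumes L_pos: "0 < L"
    and f_deriv: "\<And>x. (f has_real_derivative f' x) (at x)"
    and E_deriv: "\<And>x. (E has_real_derivative g x - f' x) (at x)"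
    and data_zero: "\<And>x. L \<le> \<bar>x\<bar> \<Longrightarrow> f x = 0 \<and> f' x = 0 \<and> g x = 0"
    and E_less: "E (- L) < E L"
begin

lemma continuous_on_E: "continuous_on S E"
  using E_deriv DERIV_isCont continuous_at_imp_continuous_on by blast

lemma E_right: "L \<le> x \<Longrightarrow> E x = E L"
  using increment_ge_of_deriv_ge[of L x E "\<lambda>x. g x - f' x" 0]
    increment_ge_of_deriv_ge[of L x "\<lambda>x. - E x" "\<lambda>x. - (g x - f' x)" 0]
    continuous_on_E[of "{L..x}"] E_deriv DERIV_minus[OF E_deriv] data_zero
  by (force intro: continuous_on_minus)

lemma E_left: "x \<le> - L \<Longrightarrow> E x = E (- L)"
  using increment_ge_of_deriv_ge[of x "- L" E "\<lambda>x. g x - f' x" 0]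
    increment_ge_of_deriv_ge[of x "- L" "\<lambda>x. - E x" "\<lambda>x. - (g x - f' x)" 0]
    continuous_on_E[of "{x..-L}"] E_deriv DERIV_minus[OF E_deriv] data_zero
  by (force intro: continuous_on_minus)

text \<open>
  On the line \<open>x - t = \<sigma>\<close> the invariant \<open>u_t - u_x\<close> starts from a multiple of \<open>g \<sigma> - f' \<sigma>\<close>, and the free
  wave eventually equals a multiple of \<open>E L - E \<sigma>\<close>; both have to be positive for one and the same \<open>\<sigma>\<close>.
  Such a \<open>\<sigma>\<close> is found before the first point \<open>z\<close> at which \<open>E\<close> reaches the level \<open>E L\<close>: left of \<open>z\<close> the
  second condition holds, and the mean value theorem on the interval from \<open>- L\<close> to \<open>z\<close>, over
  which \<open>E\<close> increases in total, gives the first.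
\<close>

lemma ex_growing_characteristic:
  obtains \<sigma> where "- L < \<sigma>" "\<sigma> < L" "f' \<sigma> < g \<sigma>" "E \<sigma> < E L"
proof -
  let ?Z = "{-L..L} \<inter> {x. E L \<le> E x}"
  have "closed {x. E L \<le> E x}"
    using continuous_on_E by (intro closed_Collect_le) auto
  then have "compact ?Z" by (intro compact_Int_closed) auto
  moreover have "?Z \<noteq> {}"
  proof -
    have "L \<in> ?Z" using L_pos by simp
    then show ?thesis by blast
  qed
  ultimately obtain z where z: "z \<in> ?Z" and min: "\<And>x. x \<in> ?Z \<Longrightarrow> z \<le> x"
    using compact_attains_inf[of ?Z] by blast
  have "- L < z" using z E_less by (cases "z = - L") auto
  from MVT2[OF this E_deriv] obtain \<sigma> where \<sigma>: "- L < \<sigma>" "\<sigma> < z"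
    and E\<sigma>: "E z - E (- L) = (z - - L) * (g \<sigma> - f' \<sigma>)" by blast
  have "0 < (z - - L) * (g \<sigma> - f' \<sigma>)" using E\<sigma> z E_less by auto
  then have "f' \<sigma> < g \<sigma>" using \<open>- L < z\<close> by (simp add: zero_less_mult_iff)
  moreover have "E \<sigma> < E L" using min[of \<sigma>] \<sigma> z by (force simp: not_le[symmetric])
  ultimately show ?thesis using that[of \<sigma>] \<sigma> z by auto
qed

end

section \<open>Lifespan bounds\<close>

locale forced_cauchy_problem = forced_wave T u F + cauchy_data f f' g E L
  for T :: real and u F :: "real \<times> real \<Rightarrow> real" and f f' g E L +
  fixes \<epsilon> :: real
  assumes eps_pos: "0 < \<epsilon>"
    and F_nonneg: "\<And>z. 0 \<le> F z"
    and u_init: "\<And>x. u (x, 0) = \<epsilon> * f x"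
    and ut_init: "\<And>x. pd_t T u (x, 0) = \<epsilon> * g x"
begin

lemma ux_init: "pd_x u (x, 0) = \<epsilon> * f' x"
proof -
  have "((\<lambda>y. u (y, 0)) has_real_derivative \<epsilon> * f' x) (at x)"
    unfolding u_init by (intro DERIV_cmult f_deriv)
  then show ?thesis by (simp add: pd_x_def DERIV_imp_deriv)
qed

lemma hR_ge:
  assumes "0 \<le> t" "t \<le> T"
  shows "\<epsilon> * (g \<xi> - f' \<xi>) \<le> hR (\<xi> + t, t)"
  using hR_increment[of 0 t 0 \<xi>] assms F_nonneg
  by (simp add: hR_def ut_init ux_init algebra_simps)

lemma hL_ge:
  assumes "0 \<le> t" "t \<le> T"
  shows "\<epsilon> * (g \<eta> + f' \<eta>) \<le> hL (\<eta> - t, t)"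
  using hL_increment[of 0 t 0 \<eta>] assms F_nonneg
  by (simp add: hL_def ut_init ux_init algebra_simps)

text \<open>
  D'Alembert's formula as an inequality: the forcing can only raise \<open>u\<close>.  Going up the line
  \<open>x + t = \<eta>\<close>, the function \<open>u\<close> has the slope \<open>u_t - u_x\<close>, which is at least its value
  \<open>\<epsilon> (g - f') (\<eta> - 2 s)\<close> at the foot of the characteristic in the other direction; this value is the
  derivative of \<open>- (\<epsilon>/2) E (\<eta> - 2 s)\<close>.
\<close>

lemma u_ge_free_wave:
  assumes "0 \<le> t" "t \<le> T"
  shows "\<epsilon> * f (x + t) + \<epsilon> / 2 * (E (x + t) - E (x - t)) \<le> u (x, t)"
proof -
  define \<eta> where "\<eta> = x + t"
  have "(u (\<eta> - 0, 0) + \<epsilon> / 2 * E (\<eta> - 2 * 0)) + 0 * (t - 0)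
      \<le> u (\<eta> - t, t) + \<epsilon> / 2 * E (\<eta> - 2 * t)"
  proof (rule increment_ge_of_deriv_ge[where \<phi> = "\<lambda>s. u (\<eta> - s, s) + \<epsilon> / 2 * E (\<eta> - 2 * s)"
      and \<phi>' = "\<lambda>s. hR (\<eta> - s, s) - \<epsilon> * (g (\<eta> - 2 * s) - f' (\<eta> - 2 * s))"])
    show "continuous_on {0..t} (\<lambda>s. u (\<eta> - s, s) + \<epsilon> / 2 * E (\<eta> - 2 * s))"
      using assms by (intro continuous_intros continuous_on_u_left
          continuous_on_compose2[OF continuous_on_E[of UNIV]]) auto
    fix s assume "s \<in> {0<..<t}"
    then have s: "s \<in> {0<..<T}" "0 \<le> s" "s \<le> T" using assms by auto
    have "((\<lambda>s. E (\<eta> - 2 * s)) has_real_derivative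
        (g (\<eta> - 2 * s) - f' (\<eta> - 2 * s)) * (- 2)) (at s)"
      by (rule DERIV_chain2[OF E_deriv]) (auto intro!: derivative_eq_intros)
    from DERIV_add[OF has_real_derivative_u_left[OF s(1), of \<eta>] DERIV_cmult[OF this, of "\<epsilon> / 2"]]
    show "((\<lambda>s. u (\<eta> - s, s) + \<epsilon> / 2 * E (\<eta> - 2 * s)) has_real_derivative
        hR (\<eta> - s, s) - \<epsilon> * (g (\<eta> - 2 * s) - f' (\<eta> - 2 * s))) (at s)"
      by (simp add: algebra_simps)
    show "0 \<le> hR (\<eta> - s, s) - \<epsilon> * (g (\<eta> - 2 * s) - f' (\<eta> - 2 * s))"
      using hR_ge[OF s(2,3), of "\<eta> - 2 * s"] by (simp add: algebra_simps)
  qed (use assms in auto)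
  then show ?thesis
    by (simp add: \<eta>_def u_init right_diff_distrib diff_divide_distrib)
qed

text \<open>
  The doubling step.  Let \<open>u \<ge> M\<close> on the cone \<open>|x| \<le> t - a\<close>, and let \<open>(x, t)\<close> lie in the cone
  \<open>|x| \<le> t - a - \<delta>\<close>.  The line through \<open>(x, t)\<close> with \<open>x + t\<close> fixed at \<open>\<eta>\<close> enters the first cone at the
  time \<open>s0\<close>.  From there up to \<open>t\<close>, a time of at least \<open>\<delta>/2\<close>, the slope \<open>u_t - u_x\<close> of \<open>u\<close> is at
  least \<open>B M^r \<delta>/2\<close>, since the characteristic in the other direction has spent a time of at least
  \<open>\<delta>/2\<close> in the cone, after starting from a point where the data vanish.
\<close>

proposition lifespan_power:
  assumes "B > 0" "r > 1"
    and F_ge: "\<And>x t. t \<in> {0..T} \<Longrightarrow> B * \<bar>u (x, t)\<bar> powr r \<le> F (x, t)"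
  shows "T < L + 2 / sqrt B / (1 - 2 powr (- ((r - 1) / 2)))
      * (\<epsilon> / 2 * (E L - E (- L))) powr (- ((r - 1) / 2))"
proof (rule doubling_blowup)
  let ?P = "\<lambda>M a. \<forall>x t. t \<le> T \<longrightarrow> \<bar>x\<bar> \<le> t - a \<longrightarrow> M \<le> u (x, t)"
  show "2 / sqrt B > 0" "(r - 1) / 2 > 0" using assms by auto
  show "0 < \<epsilon> / 2 * (E L - E (- L))" using eps_pos E_less by simp
  show "?P (\<epsilon> / 2 * (E L - E (- L))) L"
  proof (intro allI impI)
    fix x t assume t: "t \<le> T" "\<bar>x\<bar> \<le> t - L"
    then have "0 \<le> t" "L \<le> x + t" "x - t \<le> - L" using L_pos by auto
    with u_ge_free_wave[of t x] t data_zero[of "x + t"] E_right[of "x + t"] E_left[of "x - t"]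
    show "\<epsilon> / 2 * (E L - E (- L)) \<le> u (x, t)" by auto
  qed
  show "M \<le> u (0, T)" if "?P M a" "a \<le> T" for M a
    using that by auto
  show "?P (2 * M) (a + 2 / sqrt B * M powr (- ((r - 1) / 2)))"
    if M: "M > 0" and a: "a \<ge> L" and P: "?P M a" for M a
  proof (intro allI impI)
    \<comment> \<open>The width \<open>\<delta>\<close> is chosen to make the gain \<open>B M^r (\<delta>/2)^2\<close> equal to \<open>M\<close>.\<close>
    define \<delta> where "\<delta> = 2 / sqrt B * M powr (- ((r - 1) / 2))"
    have "\<delta> > 0" using M \<open>B > 0\<close> by (simp add: \<delta>_def)
    have "\<delta>\<^sup>2 = 4 / B * (M powr (- ((r - 1) / 2)))\<^sup>2"
      using \<open>B > 0\<close> by (simp add: \<delta>_def power_mult_distrib power_divide)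
    also have "(M powr (- ((r - 1) / 2)))\<^sup>2 = M powr (1 - r)"
      using M by (simp add: power2_eq_square powr_add[symmetric])
    finally have "B * M powr r * \<delta>\<^sup>2 / 4 = M powr r * M powr (1 - r)"
      using \<open>B > 0\<close> by simp
    also have "\<dots> = M" using M by (simp add: powr_add[symmetric])
    finally have gain: "B * M powr r * \<delta>\<^sup>2 / 4 = M" .
    fix x t assume t: "t \<le> T" and "\<bar>x\<bar> \<le> t - (a + 2 / sqrt B * M powr (- ((r - 1) / 2)))"
    then have x: "\<bar>x\<bar> \<le> t - a - \<delta>" by (simp add: \<delta>_def)
    define \<eta> where "\<eta> = x + t"
    define s0 where "s0 = (\<eta> + a) / 2"
    have s0: "0 \<le> s0" "s0 \<le> t" "\<delta> / 2 \<le> t - s0" "\<bar>\<eta> - s0\<bar> \<le> s0 - a" "s0 \<le> T"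
      using x t a L_pos \<open>\<delta> > 0\<close> unfolding s0_def \<eta>_def by (auto simp: field_simps abs_if split: if_splits)
    have "u (\<eta> - s0, s0) + B * M powr r * (\<delta> / 2) * (t - s0) \<le> u (\<eta> - t, t)"
    proof (rule u_increment)
      fix s assume s: "s \<in> {s0<..<t}"
      \<comment> \<open>The line of slope one through \<open>(\<eta> - s, s)\<close> starts at \<open>\<xi>\<close> and enters the cone at the time \<open>\<tau>\<close>.\<close>
      define \<xi> where "\<xi> = \<eta> - 2 * s"
      define \<tau> where "\<tau> = (a - \<xi>) / 2"
      have \<xi>: "\<xi> \<le> - a" using s by (simp add: \<xi>_def s0_def)
      then have \<tau>: "0 \<le> \<tau>" using a L_pos by (simp add: \<tau>_def)
      have s\<tau>: "\<delta> / 2 \<le> s - \<tau>" using x by (auto simp: \<tau>_def \<xi>_def \<eta>_def field_simps)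
      have "0 \<le> hR (\<xi> + \<tau>, \<tau>)"
        using hR_ge[of \<tau> \<xi>] data_zero[of \<xi>] \<xi> \<tau> a L_pos s\<tau> s t \<open>\<delta> > 0\<close> by auto
      moreover have "hR (\<xi> + \<tau>, \<tau>) + B * M powr r * (s - \<tau>) \<le> hR (\<xi> + s, s)"
      proof (rule hR_increment)
        fix y assume y: "y \<in> {\<tau><..<s}"
        then have "\<bar>\<xi> + y\<bar> \<le> y - a" "y \<le> T" "0 \<le> y"
          using \<xi> s t \<tau> by (auto simp: \<tau>_def abs_le_iff)
        then have "M \<le> u (\<xi> + y, y)" using P by blast
        then have "B * M powr r \<le> B * \<bar>u (\<xi> + y, y)\<bar> powr r"
          using M \<open>B > 0\<close> \<open>r > 1\<close> by (intro mult_left_mono powr_mono2) auto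
        also have "\<dots> \<le> F (\<xi> + y, y)" using \<open>0 \<le> y\<close> \<open>y \<le> T\<close> by (intro F_ge) auto
        finally show "B * M powr r \<le> F (\<xi> + y, y)" .
      qed (use \<tau> s\<tau> s t \<open>\<delta> > 0\<close> in auto)
      moreover have "B * M powr r * (\<delta> / 2) \<le> B * M powr r * (s - \<tau>)"
        using s\<tau> \<open>B > 0\<close> by (intro mult_left_mono) auto
      moreover have "\<xi> + s = \<eta> - s" by (simp add: \<xi>_def)
      ultimately show "B * M powr r * (\<delta> / 2) \<le> hR (\<eta> - s, s)" by simp
    qed (use s0 t in auto)
    moreover have "M \<le> u (\<eta> - s0, s0)" using P s0 by blast
    moreover have "B * M powr r * (\<delta> / 2) * (\<delta> / 2) \<le> B * M powr r * (\<delta> / 2) * (t - s0)"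
      using s0 \<open>B > 0\<close> \<open>\<delta> > 0\<close> by (intro mult_left_mono) auto
    moreover have "B * M powr r * (\<delta> / 2) * (\<delta> / 2) = M"
      using gain by (simp add: power2_eq_square)
    moreover have "\<eta> - t = x" by (simp add: \<eta>_def)
    ultimately show "2 * M \<le> u (x, t)" by (metis add_mono mult_2 order_trans)
  qed
qed

text \<open>
  Here \<open>H t = u_t - u_x\<close> is followed along \<open>x = \<sigma> + t\<close>.  From the time \<open>L\<close> on, \<open>x + t = \<sigma> + 2 t \<ge> L\<close>, so the
  other invariant comes from a point where the data vanish and is nonnegative.  Hence
  \<open>u_t \<ge> H/2\<close>, while \<open>u\<close> stays above the constant value \<open>(\<epsilon>/2) (E L - E \<sigma>)\<close> of the free wave on
  this line.
\<close>

proposition lifespan_product: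
  assumes "A > 0" "p > 1" "q > 0"
    and \<sigma>: "- L < \<sigma>" "f' \<sigma> < g \<sigma>" "E \<sigma> < E L"
    and F_ge: "\<And>x t. t \<in> {0..T} \<Longrightarrow> A * \<bar>pd_t T u (x, t)\<bar> powr p * \<bar>u (x, t)\<bar> powr q \<le> F (x, t)"
  shows "T < L + 2 powr (p + q) / (A * (E L - E \<sigma>) powr q * (1 - 2 powr (- (p - 1))))
      * (g \<sigma> - f' \<sigma>) powr (- (p - 1)) * \<epsilon> powr (- (p + q - 1))"
proof -
  define D where "D = E L - E \<sigma>"
  have "D > 0" using \<sigma> by (simp add: D_def)
  define K where "K = 2 powr (p + q) * \<epsilon> powr (- q) / (A * D powr q)"
  have "T < L + K / (1 - 2 powr (- (p - 1))) * (\<epsilon> * (g \<sigma> - f' \<sigma>)) powr (- (p - 1))"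
  proof (rule doubling_blowup)
    let ?P = "\<lambda>M a. \<forall>t. a \<le> t \<longrightarrow> t \<le> T \<longrightarrow> M \<le> hR (\<sigma> + t, t)"
    show "K > 0" using \<open>A > 0\<close> \<open>D > 0\<close> eps_pos by (simp add: K_def)
    show "p - 1 > 0" using \<open>p > 1\<close> by simp
    show "0 < \<epsilon> * (g \<sigma> - f' \<sigma>)" using eps_pos \<sigma> by simp
    show "?P (\<epsilon> * (g \<sigma> - f' \<sigma>)) L" using hR_ge[of _ \<sigma>] L_pos by auto
    show "M \<le> hR (\<sigma> + T, T)" if "?P M a" "a \<le> T" for M a using that by auto
    show "?P (2 * M) (a + K * M powr (- (p - 1)))" if M: "M > 0" and a: "a \<ge> L" and P: "?P M a" for M a
    proof (intro allI impI)
      define \<delta> where "\<delta> = K * M powr (- (p - 1))"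
      have "\<delta> > 0" using M \<open>K > 0\<close> by (simp add: \<delta>_def)
      \<comment> \<open>A lower bound for the slope of \<open>H\<close> while \<open>H \<ge> M\<close>; the constant \<open>K\<close> is made so that \<open>m \<delta> = M\<close>.\<close>
      define m where "m = A * (M / 2) powr p * (\<epsilon> / 2 * D) powr q"
      have m\<delta>: "m * \<delta> = M"
      proof -
        have "m * \<delta> = (A * (M powr p / 2 powr p) * (\<epsilon> powr q / 2 powr q * D powr q))
            * (2 powr p * 2 powr q / \<epsilon> powr q / (A * D powr q) * (M / M powr p))"
          using M eps_pos \<open>D > 0\<close>
          by (simp add: m_def \<delta>_def K_def powr_mult powr_divide powr_add powr_minus_divide powr_diff)
        also have "\<dots> = M"
          using M eps_pos \<open>D > 0\<close> \<open>A > 0\<close> by (simp add: field_simps)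
        finally show ?thesis .
      qed
      have "m \<ge> 0" using \<open>A > 0\<close> by (simp add: m_def)
      fix t assume t: "a + K * M powr (- (p - 1)) \<le> t" "t \<le> T"
      then have "a + \<delta> \<le> t" by (simp add: \<delta>_def)
      have "hR (\<sigma> + a, a) + m * (t - a) \<le> hR (\<sigma> + t, t)"
      proof (rule hR_increment)
        fix s assume "s \<in> {a<..<t}"
        then have s: "a \<le> s" "s \<le> T" "0 \<le> s" "L \<le> s" using t a L_pos by auto
        then have out: "L \<le> \<sigma> + 2 * s" using \<sigma> L_pos by auto
        have "0 \<le> hL (\<sigma> + s, s)"
          using hL_ge[OF s(3,2), of "\<sigma> + 2 * s"] data_zero[of "\<sigma> + 2 * s"] out by (simp add: algebra_simps)
        moreover have "M \<le> hR (\<sigma> + s, s)" using P s by blast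
        moreover have "pd_t T u (\<sigma> + s, s) = (hR (\<sigma> + s, s) + hL (\<sigma> + s, s)) / 2"
          by (simp add: hR_def hL_def)
        ultimately have ut: "M / 2 \<le> pd_t T u (\<sigma> + s, s)" by simp
        have "\<epsilon> / 2 * D \<le> u (\<sigma> + s, s)"
          using u_ge_free_wave[OF s(3,2), of "\<sigma> + s"] out E_right[OF out] data_zero[of "\<sigma> + 2 * s"]
          by (simp add: D_def add.assoc)
        then have "m \<le> A * \<bar>pd_t T u (\<sigma> + s, s)\<bar> powr p * \<bar>u (\<sigma> + s, s)\<bar> powr q"
          unfolding m_def using ut M eps_pos \<open>D > 0\<close> assms(1-3)
          by (intro mult_mono powr_mono2 mult_left_mono) (auto simp: abs_if)
        also have "\<dots> \<le> F (\<sigma> + s, s)" using s by (intro F_ge) auto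
        finally show "m \<le> F (\<sigma> + s, s)" .
      qed (use a L_pos t \<open>a + \<delta> \<le> t\<close> \<open>\<delta> > 0\<close> in auto)
      moreover have "m * \<delta> \<le> m * (t - a)"
        using \<open>a + \<delta> \<le> t\<close> \<open>m \<ge> 0\<close> by (intro mult_left_mono) auto
      moreover have "M \<le> hR (\<sigma> + a, a)" using P \<open>a + \<delta> \<le> t\<close> \<open>\<delta> > 0\<close> t by auto
      ultimately show "2 * M \<le> hR (\<sigma> + t, t)" using m\<delta> by simp
    qed
  qed
  also have "(\<epsilon> * (g \<sigma> - f' \<sigma>)) powr (- (p - 1)) = \<epsilon> powr (- (p - 1)) * (g \<sigma> - f' \<sigma>) powr (- (p - 1))"
    using eps_pos \<sigma> by (simp add: powr_mult)
  also have "K / (1 - 2 powr (- (p - 1))) * (\<epsilon> powr (- (p - 1)) * (g \<sigma> - f' \<sigma>) powr (- (p - 1)))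
      = 2 powr (p + q) / (A * D powr q * (1 - 2 powr (- (p - 1))))
        * (g \<sigma> - f' \<sigma>) powr (- (p - 1)) * (\<epsilon> powr (- q) * \<epsilon> powr (- (p - 1)))"
    by (simp add: K_def)
  also have "\<epsilon> powr (- q) * \<epsilon> powr (- (p - 1)) = \<epsilon> powr (- (p + q - 1))"
    by (simp add: powr_add[symmetric] diff_diff_eq)
  finally show ?thesis by (simp add: D_def)
qed

end

section \<open>The combined lifespan estimate\<close>

lemma eq_0_outside_supp:
  assumes "supp f \<subseteq> {x. \<bar>x\<bar> \<le> R}" "R < \<bar>x\<bar>"
  shows "f x = 0"
  using assms closure_subset[of "{x. f x \<noteq> 0}"] unfolding supp_def by fastforce

text \<open>
  The radius is enlarged from \<open>R\<close> to \<open>R + 1\<close> so that \<open>f\<close> vanishes in a neighbourhood of every point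
  with \<open>|x| \<ge> R + 1\<close>; then its derivative vanishes there as well.
\<close>

lemma cauchy_data_of_supp:
  assumes f: "f \<in> C0k 2" and g: "g \<in> C0k 1" and "0 < R"
    and sf: "supp f \<subseteq> {x. \<bar>x\<bar> \<le> R}" and sg: "supp g \<subseteq> {x. \<bar>x\<bar> \<le> R}"
    and pos: "(LINT x|lborel. g x) > 0"
  obtains E where "cauchy_data f (deriv f) g E (R + 1)"
proof -
  have f_deriv: "(f has_real_derivative deriv f x) (at x)" for x
    using f by (auto simp: C0k_def numeral_2_eq_2 DERIV_deriv_iff_real_differentiable)
  have g_cont: "isCont g x" for x
  proof -
    have "g differentiable (at x)" using g by (simp add: C0k_def)
    then show ?thesis by (rule differentiable_imp_continuous_within)
  qed
  obtain G where "\<forall>x::real. - \<infinity> < ereal x \<longrightarrow> ereal x < \<infinity> \<longrightarrow> (G has_vector_derivative g x) (at x)"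
    using einterval_antiderivative[of "- \<infinity>" \<infinity> g] g_cont by auto
  then have G: "(G has_real_derivative g x) (at x)" for x
    by (simp add: has_real_derivative_iff_has_vector_derivative)
  have g0: "g x = 0" "f x = 0" if "R < \<bar>x\<bar>" for x
    using eq_0_outside_supp sf sg that by auto
  have f'0: "deriv f x = 0" if "R < \<bar>x\<bar>" for x
  proof -
    have "open {x::real. R < \<bar>x\<bar>}" by (intro open_Collect_less continuous_intros)
    then have "(f has_real_derivative 0) (at x)"
      using that g0(2)
      by (auto intro: has_field_derivative_transform_within_open[of "\<lambda>_. 0" 0 x "{x. R < \<bar>x\<bar>}"])
    then show ?thesis by (rule DERIV_imp_deriv)
  qed
  have "g x * indicator {- (R + 1)..R + 1} x = g x" for x
    using g0(1)[of x] by (cases "R < \<bar>x\<bar>") (auto simp: indicator_def)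
  then have "(\<lambda>x. g x * indicator {- (R + 1)..R + 1} x) = g" by (rule ext)
  then have "(LINT x|lborel. g x) = G (R + 1) - G (- (R + 1))"
    using integral_FTC_Icc_real[of "- (R + 1)" "R + 1" G g] \<open>0 < R\<close> G g_cont by simp
  then have "G (- (R + 1)) < G (R + 1)" using pos by simp
  then have "cauchy_data f (deriv f) g (\<lambda>x. G x - f x) (R + 1)"
    using \<open>0 < R\<close> f_deriv G g0 f'0 by unfold_locales (auto intro!: DERIV_diff)
  then show ?thesis by (rule that)
qed

theorem theorem2p3:
  fixes p q r A B R :: real and f g :: "real \<Rightarrow> real"
  assumes "p > 1" and "q > 1" and "r > 1"
    and "A > 0" and "B > 0" and "R \<ge> 1"
    and "f \<in> C0k 2" and "g \<in> C0k 1"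
    and "supp f \<subseteq> {x. \<bar>x\<bar> \<le> R}" and "supp g \<subseteq> {x. \<bar>x\<bar> \<le> R}"
    and "(LINT x|lborel. g x) > 0"
  shows "\<exists>\<epsilon>\<^sub>3>0. \<exists>C>0. \<forall>\<epsilon>. 0 < \<epsilon> \<and> \<epsilon> \<le> \<epsilon>\<^sub>3 \<longrightarrow>
           (\<forall>T. (p + q \<le> (r + 1) / 2 \<longrightarrow> T \<ge> C * \<epsilon> powr (- (p + q - 1))) \<and>
                ((r + 1) / 2 \<le> p + q \<longrightarrow> T \<ge> C * \<epsilon> powr (- ((r - 1) / 2))) \<longrightarrow>
                \<not> (\<exists>u. classical_solution p q r A B f g \<epsilon> T u))"
proof -
  define L where "L = R + 1"
  obtain E where "cauchy_data f (deriv f) g E L"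
    using cauchy_data_of_supp[OF assms(7,8) _ assms(9-11)] \<open>R \<ge> 1\<close> unfolding L_def by auto
  then interpret cauchy_data f "deriv f" g E L .
  obtain \<sigma> where \<sigma>: "- L < \<sigma>" "deriv f \<sigma> < g \<sigma>" "E \<sigma> < E L"
    using ex_growing_characteristic by metis
  define C1 where "C1 = 2 powr (p + q) / (A * (E L - E \<sigma>) powr q * (1 - 2 powr (- (p - 1))))
      * (g \<sigma> - deriv f \<sigma>) powr (- (p - 1))"
  define C2 where "C2 = 2 / sqrt B / (1 - 2 powr (- ((r - 1) / 2)))
      * (1 / 2 * (E L - E (- L))) powr (- ((r - 1) / 2))"
  define C where "C = L + max C1 C2"
  have "C1 > 0" using assms \<sigma> by (auto simp: C1_def intro!: mult_pos_pos divide_pos_pos powr_less_one)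
  then have "C > 0" using L_pos by (simp add: C_def)
  have "\<not> classical_solution p q r A B f g \<epsilon> T u"
    if \<epsilon>: "0 < \<epsilon>" "\<epsilon> \<le> 1"
      and T1: "p + q \<le> (r + 1) / 2 \<longrightarrow> T \<ge> C * \<epsilon> powr (- (p + q - 1))"
      and T2: "(r + 1) / 2 \<le> p + q \<longrightarrow> T \<ge> C * \<epsilon> powr (- ((r - 1) / 2))" for \<epsilon> T u
  proof
    assume sol: "classical_solution p q r A B f g \<epsilon> T u"
    define F where "F z = A * \<bar>pd_t T u z\<bar> powr p * \<bar>u z\<bar> powr q + B * \<bar>u z\<bar> powr r" for z
    interpret forced_cauchy_problem T u F f "deriv f" g E L \<epsilon>
      using sol \<epsilon> assms by unfold_locales (auto simp: classical_solution_def F_def)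
    \<comment> \<open>Since \<open>\<epsilon> \<le> 1\<close>, the waiting time \<open>L\<close> is absorbed into the power of \<open>\<epsilon>\<close>.\<close>
    have below: "L + c * \<epsilon> powr (- s) \<le> C * \<epsilon> powr (- s)" if "c \<le> max C1 C2" "0 \<le> s" for c s
    proof -
      have "1 \<le> \<epsilon> powr (- s)" using \<epsilon> that powr_mono'[of "- s" 0 \<epsilon>] by simp
      then have "L * 1 + c * \<epsilon> powr (- s) \<le> L * \<epsilon> powr (- s) + max C1 C2 * \<epsilon> powr (- s)"
        using that L_pos by (intro add_mono mult_left_mono mult_right_mono) auto
      then show ?thesis by (simp add: C_def algebra_simps)
    qed
    have "T < L + C1 * \<epsilon> powr (- (p + q - 1))"
      unfolding C1_def using assms \<sigma> by (intro lifespan_product) (auto simp: F_def)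
    moreover have "T < L + C2 * \<epsilon> powr (- ((r - 1) / 2))"
    proof -
      have "T < L + 2 / sqrt B / (1 - 2 powr (- ((r - 1) / 2)))
          * (\<epsilon> / 2 * (E L - E (- L))) powr (- ((r - 1) / 2))"
        using assms by (intro lifespan_power) (auto simp: F_def)
      also have "(\<epsilon> / 2 * (E L - E (- L))) powr (- ((r - 1) / 2))
          = (1 / 2 * (E L - E (- L))) powr (- ((r - 1) / 2)) * \<epsilon> powr (- ((r - 1) / 2))"
        using \<epsilon> E_less powr_mult[of "1 / 2 * (E L - E (- L))" \<epsilon>] by (simp add: mult.commute)
      finally show ?thesis by (simp add: C2_def mult.assoc)
    qed
    moreover have "L + C1 * \<epsilon> powr (- (p + q - 1)) \<le> C * \<epsilon> powr (- (p + q - 1))"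
      using assms by (intro below) auto
    moreover have "L + C2 * \<epsilon> powr (- ((r - 1) / 2)) \<le> C * \<epsilon> powr (- ((r - 1) / 2))"
      using assms by (intro below) auto
    ultimately show False using T1 T2 by linarith
  qed
  then show ?thesis using \<open>C > 0\<close> by (intro exI[of _ 1] exI[of _ C] conjI) auto
qed

end
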